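(* Let $i\in\{1,2,2\frac12\}$. The cardinal $\mathfrak q_i$ is equal to the smallest cardinality of a non-perfect second-countable $T_i$-space.
   Context: A subset of a topological space is of type $F_\sigma$ if it can be written as the union of countably many closed sets. A topological space $X$ is perfect if every open subset of $X$ is of type $F_\sigma$ in $X$; it is non-perfect if it is not perfect. A topological space $X$ is a $Q$-space if every subset of $X$ is of type $F_\sigma$ in $X$. A topological space $X$ is a $T_1$-space if every finite subset of $X$ is closed in $X$; a $T_2$-space if it is Hausdorff, i.e. any distinct points of $X$ have disjoint neighborhoods; a $T_{2\frac12}$-space if it is Urysohn, i.e. any distinct points of $X$ have disjoint closed neighborhoods. $X$ is second-countable if it has a countable base of the topology. For $i\in\{1,2,2\frac12\}$, $\mathfrak q_i$ denotes the smallest cardinality of a second-countable $T_i$-space which is not a $Q$-space. *)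

theory Defs
  imports "HOL-Analysis.Analysis"
begin

unbundle cardinal_syntax

definition Q_space :: "'a topology \<Rightarrow> bool" where
  "Q_space X \<longleftrightarrow> (\<forall>A. A \<subseteq> topspace X \<longrightarrow> fsigma_in X A)"

text \<open>Not to be confused with the library's type class \<open>perfect_space\<close> (no isolated points).\<close>

definition perfect_topology :: "'a topology \<Rightarrow> bool" where
  "perfect_topology X \<longleftrightarrow> (\<forall>U. openin X U \<longrightarrow> fsigma_in X U)"

text \<open>Neighbourhoods are not required to be open: a neighbourhood of \<open>x\<close> is a set with \<open>x\<close>
  in its interior.\<close>

definition Urysohn_space :: "'a topology \<Rightarrow> bool" where
  "Urysohn_space X \<longleftrightarrow>
    (\<forall>x y. x \<in> topspace X \<and> y \<in> topspace X \<and> x \<noteq> y \<longrightarrow>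
      (\<exists>F G. closedin X F \<and> closedin X G \<and> x \<in> X interior_of F \<and> y \<in> X interior_of G \<and>
             disjnt F G))"

datatype separation = T1 | T2 | T2half

text \<open>For the formulation of \<open>T\<^sub>1\<close> by closed finite sets see \<open>t1_space_closedin_finite\<close>.\<close>

primrec separated :: "separation \<Rightarrow> 'a topology \<Rightarrow> bool" where
  "separated T1 X = t1_space X"
| "separated T2 X = Hausdorff_space X"
| "separated T2half X = Urysohn_space X"

definition smallest_cardinality :: "('a topology \<Rightarrow> bool) \<Rightarrow> 'b rel \<Rightarrow> bool" where
  "smallest_cardinality P \<kappa> \<longleftrightarrow>
    Card_order \<kappa> \<and> (\<exists>X. P X \<and> |topspace X| =o \<kappa>) \<and> (\<forall>X. P X \<longrightarrow> \<kappa> \<le>o |topspace X| )"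

text \<open>A second-countable \<open>T\<^sub>1\<close>-space has at most continuum many points, so it is homeomorphic
  to a space whose points are real numbers; minimizing over these spaces is therefore the same
  as minimizing over all spaces (\<open>qq_le\<close> below). The choice operator is applied to a
  satisfiable predicate (\<open>smallest_cardinality_qq\<close> below), which determines the
  cardinal up to \<open>=o\<close>.\<close>

definition qq :: "separation \<Rightarrow> real rel" where
  "qq i = (SOME \<kappa>. smallest_cardinality
     (\<lambda>X :: real topology. second_countable X \<and> separated i X \<and> \<not> Q_space X) \<kappa>)"

lemma Urysohn_imp_Hausdorff_space:
  assumes "Urysohn_space X" shows "Hausdorff_space X"
  unfolding Hausdorff_space_def
proof (intro allI impI)
  fix x y assume "x \<in> topspace X \<and> y \<in> topspace X \<and> x \<noteq> y"
  then obtain F G where "x \<in> X interior_of F" "y \<in> X interior_of G" "disjnt F G"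
    using assms unfolding Urysohn_space_def by meson
  then show "\<exists>U V. openin X U \<and> openin X V \<and> x \<in> U \<and> y \<in> V \<and> disjnt U V"
    by (meson disjnt_subset1 disjnt_subset2 interior_of_subset openin_interior_of)
qed

lemma separated_imp_t1_space: "separated i X \<Longrightarrow> t1_space X"
  by (cases i) (auto simp: Hausdorff_imp_t1_space Urysohn_imp_Hausdorff_space)

lemma homeomorphic_Urysohn_space:
  assumes "X homeomorphic_space Y" "Urysohn_space X"
  shows "Urysohn_space Y"
  unfolding Urysohn_space_def
proof (intro allI impI)
  obtain f where f: "homeomorphic_map X Y f"
    using assms(1) homeomorphic_space by blast
  have img: "f ` topspace X = topspace Y"
    using homeomorphic_imp_surjective_map[OF f] .
  fix u v assume uv: "u \<in> topspace Y \<and> v \<in> topspace Y \<and> u \<noteq> v"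
  obtain x where x: "x \<in> topspace X" "u = f x"
    using uv img by (metis imageE)
  obtain y where y: "y \<in> topspace X" "v = f y"
    using uv img by (metis imageE)
  have xy: "x \<in> topspace X" "y \<in> topspace X" "x \<noteq> y" "u = f x" "v = f y"
    using x y uv by auto
  then obtain F G where FG: "closedin X F" "closedin X G" "x \<in> X interior_of F"
      "y \<in> X interior_of G" "disjnt F G"
    using assms(2) unfolding Urysohn_space_def by meson
  then have sub: "F \<subseteq> topspace X" "G \<subseteq> topspace X"
    by (simp_all add: closedin_subset)
  have "closedin Y (f ` F)" "closedin Y (f ` G)"
    using FG(1,2) homeomorphic_map_closedness[OF f sub(1)] homeomorphic_map_closedness[OF f sub(2)]
    by simp_all
  moreover have "u \<in> Y interior_of (f ` F)" "v \<in> Y interior_of (f ` G)"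
    using FG xy sub by (simp_all add: homeomorphic_map_interior_of[OF f])
  moreover have "disjnt (f ` F) (f ` G)"
    using FG(5) inj_on_image_Int[OF homeomorphic_imp_injective_map[OF f] sub]
    unfolding disjnt_def by (metis image_empty)
  ultimately show "\<exists>F G. closedin Y F \<and> closedin Y G \<and> u \<in> Y interior_of F \<and>
      v \<in> Y interior_of G \<and> disjnt F G"
    by blast
qed

lemma homeomorphic_separated:
  assumes "X homeomorphic_space Y" "separated i X"
  shows "separated i Y"
proof (cases i)
  case T1
  then show ?thesis
    using assms homeomorphic_t1_space[OF assms(1)] by simp
next
  case T2
  then show ?thesis
    using assms homeomorphic_Hausdorff_space[OF assms(1)] by simp
next
  case T2half
  then show ?thesis
    using assms homeomorphic_Urysohn_space[OF assms(1)] by simp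
qed

lemma homeomorphic_Q_space:
  assumes "X homeomorphic_space Y" "Q_space X"
  shows "Q_space Y"
  unfolding Q_space_def
proof (intro allI impI)
  obtain f where f: "homeomorphic_map Y X f"
    using assms(1) homeomorphic_space homeomorphic_space_sym by blast
  fix A assume A: "A \<subseteq> topspace Y"
  then have "fsigma_in X (f ` A)"
    using assms(2) homeomorphic_imp_surjective_map[OF f] unfolding Q_space_def
    by (metis image_mono)
  then show "fsigma_in Y A"
    using homeomorphic_map_fsigmaness[OF f A] by simp
qed

lemma second_countable_t1_lepoll_real:
  fixes X :: "'a topology"
  assumes "second_countable X" "t1_space X"
  shows "topspace X \<lesssim> (UNIV :: real set)"
proof -
  obtain B where B: "countable B" "\<And>V. V \<in> B \<Longrightarrow> openin X V"
      "\<And>U x. openin X U \<Longrightarrow> x \<in> U \<Longrightarrow> \<exists>V\<in>B. x \<in> V \<and> V \<subseteq> U"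
    using assms(1) unfolding second_countable_def by meson
  define f where "f x = to_nat_on B ` {V \<in> B. x \<in> V}" for x
  have "inj_on f (topspace X)"
  proof (rule inj_onI, rule ccontr)
    fix x y assume xy: "x \<in> topspace X" "y \<in> topspace X" "f x = f y" "x \<noteq> y"
    then obtain U where "openin X U" "x \<in> U" "y \<notin> U"
      using assms(2) unfolding t1_space_def by meson
    then obtain V where V: "V \<in> B" "x \<in> V" "y \<notin> V"
      using B(3) by (meson subsetD)
    have "{V \<in> B. x \<in> V} = {V \<in> B. y \<in> V}"
      using xy(3) inj_on_image_eq_iff[OF inj_on_to_nat_on[OF B(1)]]
      unfolding f_def by (metis (no_types, lifting) mem_Collect_eq subsetI)
    then show False using V by blast
  qed
  then have "topspace X \<lesssim> (UNIV :: nat set set)"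
    unfolding lepoll_def by blast
  then show ?thesis
    using nat_sets_eqpoll_reals lepoll_trans2 by blast
qed

lemma homeomorphic_real_copy:
  fixes X :: "'a topology"
  assumes "second_countable X" "t1_space X"
  obtains Y :: "real topology" where "X homeomorphic_space Y"
proof -
  obtain f :: "'a \<Rightarrow> real" where f: "inj_on f (topspace X)"
    using second_countable_t1_lepoll_real[OF assms] unfolding lepoll_def by blast
  define g where "g = inv_into (topspace X) f"
  define Y where "Y = pullback_topology (f ` topspace X) g X"
  have gf: "g (f x) = x" if "x \<in> topspace X" for x
    using f that by (simp add: g_def)
  have top: "topspace Y = f ` topspace X"
    using gf by (auto simp: Y_def topspace_pullback_topology)
  have opY: "openin Y S \<longleftrightarrow> (\<exists>U. openin X U \<and> S = f ` U)" for S
  proof -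
    have "g -` U \<inter> f ` topspace X = f ` U" if "openin X U" for U
      using gf openin_subset[OF that] by force
    then show ?thesis
      unfolding Y_def openin_pullback_topology by metis
  qed
  have "homeomorphic_map X Y f"
  proof (rule bijective_open_imp_homeomorphic_map)
    show "continuous_map X Y f"
      unfolding continuous_map_def
    proof (intro conjI allI impI)
      show "f \<in> topspace X \<rightarrow> topspace Y" using top by blast
      fix S assume "openin Y S"
      then obtain U where U: "openin X U" "S = f ` U" using opY by blast
      then have "{x \<in> topspace X. f x \<in> S} = U"
        using f openin_subset[OF U(1)] by (auto simp: inj_on_def) 
      then show "openin X {x \<in> topspace X. f x \<in> S}" using U by simp
    qed
    show "open_map X Y f" using opY unfolding open_map_def by blast
  qed (use top f in auto)
  then show thesis using that homeomorphic_space by blast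
qed

lemma not_Q_space_euclideanreal: "\<not> Q_space (euclidean :: real topology)"
proof
  assume "Q_space (euclidean :: real topology)"
  then have "fsigma_in (euclidean :: real topology) (- \<rat>)"
    unfolding Q_space_def by simp
  then have "\<exists>\<C>. countable \<C> \<and> \<C> \<subseteq> Collect closed \<and> \<Union>\<C> = - (\<rat> :: real set)"
    unfolding fsigma_in_def union_of_def by (metis (no_types, lifting) closed_closedin Collect_cong)
  then obtain \<C> where \<C>: "countable \<C>" "\<And>C. C \<in> \<C> \<Longrightarrow> closed C" "\<Union>\<C> = - (\<rat> :: real set)"
    by blast
  define \<G> where "\<G> = \<C> \<union> (\<lambda>q. {q}) ` (\<rat> :: real set)"
  have "euclidean interior_of \<Union>\<G> = {}"
  proof (rule Baire_category_alt)
    show "completely_metrizable_space (euclidean :: real topology) \<or>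
        locally_compact_space (euclidean :: real topology) \<and> regular_space (euclidean :: real topology)"
      by (simp add: completely_metrizable_space_euclidean)
    show "countable \<G>" using \<C> by (simp add: \<G>_def countable_rat)
    fix T assume "T \<in> \<G>"
    then consider "T \<in> \<C>" | q where "T = {q}" unfolding \<G>_def by blast
    then show "closedin euclidean T \<and> euclidean interior_of T = {}"
    proof cases
      case 1
      have "interior T = {}"
      proof (rule ccontr)
        assume "interior T \<noteq> {}"
        then obtain x e where e: "e > 0" "ball x e \<subseteq> T"
          using mem_interior by blast
        obtain q where q: "q \<in> \<rat>" "x < q" "q < x + e"
          using Rats_dense_in_real[of x "x + e"] e(1) by auto
        then have "q \<in> T" using e by (auto simp: dist_real_def)
        then show False using 1 \<C>(3) q(1) by blast
      qed
      then show ?thesis using 1 \<C>(2) by simp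
    next
      case 2
      then show ?thesis using interior_singleton[of q] by simp
    qed
  qed
  moreover have "\<Union>\<G> = UNIV" using \<C>(3) unfolding \<G>_def by (auto simp: Union_Un_distrib)
  ultimately show False by (metis UNIV_not_empty interior_of_topspace topspace_euclidean)
qed

lemma second_countable_euclideanreal: "second_countable (euclidean :: real topology)"
proof -
  obtain B :: "real set set" where "countable B" "\<And>C. C \<in> B \<Longrightarrow> open C"
      "\<And>S. open S \<Longrightarrow> \<exists>U. U \<subseteq> B \<and> S = \<Union>U"
    using univ_second_countable by metis
  then show ?thesis unfolding second_countable_def
    by (intro exI[of _ B]) (metis UnionE Union_upper open_openin subsetD)
qed

lemma Urysohn_space_euclideanreal: "Urysohn_space (euclidean :: real topology)"
  unfolding Urysohn_space_def
proof (intro allI impI)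
  fix x y :: real assume "x \<in> topspace euclidean \<and> y \<in> topspace euclidean \<and> x \<noteq> y"
  then have xy: "dist x y > 0" by simp
  let ?r = "dist x y / 3"
  have "disjnt (cball x ?r) (cball y ?r)"
    using xy unfolding disjnt_def by (intro disjoint_cballI) simp
  moreover have "x \<in> euclidean interior_of (cball x ?r)" "y \<in> euclidean interior_of (cball y ?r)"
    using xy by simp_all
  ultimately show "\<exists>F G. closedin euclidean F \<and> closedin euclidean G \<and>
      x \<in> euclidean interior_of F \<and> y \<in> euclidean interior_of G \<and> disjnt F G"
    by (metis closed_cball closed_closedin)
qed

lemma separated_euclideanreal: "separated i (euclidean :: real topology)"
  using Urysohn_space_euclideanreal Urysohn_imp_Hausdorff_space Hausdorff_imp_t1_space
  by (cases i) auto

lemma smallest_cardinality_exists: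
  fixes P :: "'a topology \<Rightarrow> bool"
  assumes "P X0"
  shows "\<exists>\<kappa> :: 'a rel. smallest_cardinality P \<kappa>"
proof -
  let ?R = "{|topspace X| | X. P X}"
  have "?R \<noteq> {}" using assms by blast
  moreover have "\<forall>r\<in>?R. Card_order r" using card_of_Card_order by blast
  ultimately obtain r where r: "r \<in> ?R" "\<forall>r'\<in>?R. r \<le>o r'"
    using exists_minim_Card_order[of ?R] by blast
  then obtain X where X: "P X" "r = |topspace X|" by blast
  have "|topspace X| =o r" using X card_of_refl by metis
  moreover have "r \<le>o |topspace Z|" if "P Z" for Z using r(2) that by blast
  ultimately have "smallest_cardinality P r"
    unfolding smallest_cardinality_def using X(1) card_of_Card_order X(2) by blast
  then show ?thesis ..
qed

lemma smallest_cardinality_qq: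
  "smallest_cardinality
     (\<lambda>X :: real topology. second_countable X \<and> separated i X \<and> \<not> Q_space X) (qq i)"
  unfolding qq_def
  by (rule someI_ex, rule smallest_cardinality_exists[of _ euclidean])
     (simp add: second_countable_euclideanreal separated_euclideanreal not_Q_space_euclideanreal)

lemma qq_le:
  fixes X :: "'a topology"
  assumes "second_countable X" "separated i X" "\<not> Q_space X"
  shows "qq i \<le>o |topspace X|"
proof -
  obtain Y :: "real topology" where Y: "X homeomorphic_space Y"
    using homeomorphic_real_copy[OF assms(1) separated_imp_t1_space[OF assms(2)]] .
  have "second_countable Y" "separated i Y" "\<not> Q_space Y"
    using assms Y homeomorphic_space_second_countability homeomorphic_separated
      homeomorphic_Q_space homeomorphic_space_sym by blast+
  then have "qq i \<le>o |topspace Y|"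
    using smallest_cardinality_qq[of i] unfolding smallest_cardinality_def by blast
  moreover obtain f where "homeomorphic_map Y X f"
    using Y homeomorphic_space homeomorphic_space_sym by blast
  then have "|topspace Y| \<le>o |topspace X|"
    using homeomorphic_imp_injective_map homeomorphic_imp_surjective_map
    by (metis card_of_ordLeq order_refl)
  ultimately show ?thesis using ordLeq_transitive by blast
qed

end

theory Submission
  imports Defs
begin

text \<open>A non-perfect space has an open subset that is not \<open>F\<^sub>\<sigma>\<close>, so it is not a \<open>Q\<close>-space; this gives
  one inequality between the two minima. Conversely, let \<open>A\<close> be a subset of a second-countable
  \<open>T\<^sub>i\<close>-space \<open>X\<close>
  that is not \<open>F\<^sub>\<sigma>\<close>. The coarsest refinement of the topology in which \<open>A\<close> becomes open lives on the
  same points, again has a countable base, and is still \<open>T\<^sub>i\<close>, because these separation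
  axioms pass to finer topologies. The refinement may have more closed sets, but none of
  the new ones lies inside \<open>A\<close> (\<open>closedin_adjoin_open_subset\<close>). So the open set \<open>A\<close> is still not
  \<open>F\<^sub>\<sigma>\<close>, and the refined space is non-perfect of the same cardinality as \<open>X\<close>.\<close>

definition adjoin_open :: "'a topology \<Rightarrow> 'a set \<Rightarrow> 'a topology" where
  "adjoin_open X A = topology (\<lambda>W. \<exists>U V. openin X U \<and> openin X V \<and> W = U \<union> V \<inter> A)"

lemma openin_adjoin_open:
  "openin (adjoin_open X A) W \<longleftrightarrow> (\<exists>U V. openin X U \<and> openin X V \<and> W = U \<union> V \<inter> A)"
proof -
  let ?P = "\<lambda>W. \<exists>U V. openin X U \<and> openin X V \<and> W = U \<union> V \<inter> A"
  have "istopology ?P"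
    unfolding istopology_def
  proof (intro conjI allI impI)
    fix S T assume "?P S" "?P T"
    then obtain U V U' V' where o: "openin X U" "openin X V" "openin X U'" "openin X V'"
      and eq: "S = U \<union> V \<inter> A" "T = U' \<union> V' \<inter> A" by blast
    have "S \<inter> T = (U \<inter> U') \<union> (U \<inter> V' \<union> V \<inter> U' \<union> V \<inter> V') \<inter> A"
      unfolding eq by blast
    moreover have "openin X (U \<inter> U')" "openin X (U \<inter> V' \<union> V \<inter> U' \<union> V \<inter> V')"
      using o by blast+
    ultimately show "?P (S \<inter> T)" by blast
  next
    fix K assume K: "\<forall>S\<in>K. ?P S"
    \<comment> \<open>Taking all admissible \<open>U\<close> and \<open>V\<close> avoids choosing a pair for each member of \<open>K\<close>.\<close>
    let ?U = "\<Union>{U. openin X U \<and> U \<subseteq> \<Union>K}" and ?V = "\<Union>{V. openin X V \<and> V \<inter> A \<subseteq> \<Union>K}"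
    have "\<Union>K \<subseteq> ?U \<union> ?V \<inter> A"
    proof
      fix x assume "x \<in> \<Union>K"
      then obtain S where S: "S \<in> K" "x \<in> S" by blast
      then obtain U V where "openin X U" "openin X V" "S = U \<union> V \<inter> A" using K by meson
      moreover from this have "U \<subseteq> \<Union>K" "V \<inter> A \<subseteq> \<Union>K" using S by blast+
      ultimately show "x \<in> ?U \<union> ?V \<inter> A" using S(2) by blast
    qed
    then have "\<Union>K = ?U \<union> ?V \<inter> A" by blast
    moreover have "openin X ?U" "openin X ?V" by blast+
    ultimately show "?P (\<Union>K)" by blast
  qed
  then show ?thesis
    unfolding adjoin_open_def by (simp add: topology_inverse')
qed

lemma openin_imp_openin_adjoin_open: "openin X U \<Longrightarrow> openin (adjoin_open X A) U"
  unfolding openin_adjoin_open by (metis Int_empty_left Un_empty_right openin_empty)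

lemma topspace_adjoin_open [simp]: "topspace (adjoin_open X A) = topspace X"
proof
  obtain U V where "openin X U" "openin X V" "topspace (adjoin_open X A) = U \<union> V \<inter> A"
    using openin_topspace[of "adjoin_open X A"] unfolding openin_adjoin_open by blast
  then show "topspace (adjoin_open X A) \<subseteq> topspace X"
    using openin_subset by fastforce
  show "topspace X \<subseteq> topspace (adjoin_open X A)"
    by (intro openin_subset openin_imp_openin_adjoin_open openin_topspace)
qed

lemma openin_adjoin_open_self:
  assumes "A \<subseteq> topspace X" shows "openin (adjoin_open X A) A"
  unfolding openin_adjoin_open
  using assms by (intro exI[of _ "{}"] exI[of _ "topspace X"]) auto

lemma second_countable_adjoin_open:
  assumes "second_countable X" shows "second_countable (adjoin_open X A)"
proof -
  obtain B where B: "countable B" "\<And>V. V \<in> B \<Longrightarrow> openin X V"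
      "\<And>U x. openin X U \<Longrightarrow> x \<in> U \<Longrightarrow> \<exists>V\<in>B. x \<in> V \<and> V \<subseteq> U"
    using assms unfolding second_countable_def by meson
  let ?B = "B \<union> (\<lambda>V. V \<inter> A) ` B"
  have countable: "countable ?B" using B(1) by simp
  have opens: "openin (adjoin_open X A) W" if W: "W \<in> ?B" for W
  proof (cases "W \<in> B")
    case True
    then show ?thesis by (simp add: B(2) openin_imp_openin_adjoin_open)
  next
    case False
    then obtain V where "V \<in> B" "W = {} \<union> V \<inter> A" using W by auto
    then show ?thesis
      unfolding openin_adjoin_open by (intro exI[of _ "{}"] exI[of _ V]) (simp add: B(2))
  qed
  have base: "\<exists>W\<in>?B. x \<in> W \<and> W \<subseteq> S" if S: "openin (adjoin_open X A) S" and x: "x \<in> S" for S x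
  proof -
    obtain U V where UV: "openin X U" "openin X V" "S = U \<union> V \<inter> A"
      using S unfolding openin_adjoin_open by blast
    show ?thesis
    proof (cases "x \<in> U")
      case True
      then obtain W where "W \<in> B" "x \<in> W" "W \<subseteq> U" using B(3)[OF UV(1)] by meson
      then show ?thesis using UV(3) by (intro bexI[of _ W]) auto
    next
      case False
      then have "x \<in> V" "x \<in> A" using x UV(3) by auto
      then obtain W where "W \<in> B" "x \<in> W" "W \<subseteq> V" using B(3)[OF UV(2)] by meson
      then show ?thesis using UV(3) \<open>x \<in> A\<close> by (intro bexI[of _ "W \<inter> A"]) auto
    qed
  qed
  show ?thesis
    unfolding second_countable_def
    by (intro exI[of _ ?B] conjI ballI allI impI) (rule countable, erule opens, elim conjE, rule base)
qed

text \<open>For the Urysohn property, refining enlarges interiors and keeps closed sets closed, so the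
  separating closed neighbourhoods can be reused unchanged.\<close>

lemma separated_finer_topology:
  assumes "separated i X" and top: "topspace Y = topspace X"
    and finer: "\<And>U. openin X U \<Longrightarrow> openin Y U"
  shows "separated i Y"
proof (cases i)
  case T1
  then have "t1_space X" using assms(1) by simp
  then have "t1_space Y" unfolding t1_space_def top by (meson finer)
  then show ?thesis using T1 by simp
next
  case T2
  then have "Hausdorff_space X" using assms(1) by simp
  then have "Hausdorff_space Y" unfolding Hausdorff_space_def top by (meson finer)
  then show ?thesis using T2 by simp
next
  case T2half
  have closed: "closedin Y F" if "closedin X F" for F
    using that finer by (simp add: closedin_def top)
  have int: "X interior_of F \<subseteq> Y interior_of F" for F
    by (simp add: finer interior_of_maximal interior_of_subset)
  have "Urysohn_space X" using T2half assms(1) by simp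
  then have "Urysohn_space Y"
    unfolding Urysohn_space_def top by (meson closed int subsetD)
  then show ?thesis using T2half by simp
qed

text \<open>The complement of a set \<open>F \<subseteq> A\<close> closed in the refinement has the form \<open>U \<union> V \<inter> A\<close>.
  It contains all points outside \<open>A\<close>, and these
  must come from \<open>U\<close>; so \<open>U\<close> covers the complement of \<open>A\<close> and intersecting \<open>V\<close> with \<open>A\<close>
  makes no difference: the complement of \<open>F\<close> is \<open>U \<union> V\<close>.\<close>

lemma closedin_adjoin_open_subset:
  assumes "closedin (adjoin_open X A) F" "F \<subseteq> A"
  shows "closedin X F"
proof -
  obtain U V where UV: "openin X U" "openin X V" "topspace X - F = U \<union> V \<inter> A"
    using assms(1) unfolding closedin_def openin_adjoin_open topspace_adjoin_open by blast
  have "topspace X - F = U \<union> V"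
    using UV(3) assms(2) openin_subset[OF UV(2)] by blast
  then have "openin X (topspace X - F)" using UV(1,2) by (metis openin_Un)
  then show ?thesis
    using closedin_subset[OF assms(1)] by (simp add: closedin_def)
qed

lemma fsigma_in_adjoin_open_self:
  assumes "fsigma_in (adjoin_open X A) A" shows "fsigma_in X A"
proof -
  obtain \<C> where "countable \<C>" "\<C> \<subseteq> Collect (closedin (adjoin_open X A))" "\<Union>\<C> = A"
    using assms unfolding fsigma_in_def union_of_def by blast
  moreover from this have "\<C> \<subseteq> Collect (closedin X)"
    using closedin_adjoin_open_subset by blast
  ultimately show ?thesis unfolding fsigma_in_def union_of_def by blast
qed

lemma not_perfect_adjoin_open:
  assumes "A \<subseteq> topspace X" "\<not> fsigma_in X A"
  shows "\<not> perfect_topology (adjoin_open X A)"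
  using assms fsigma_in_adjoin_open_self openin_adjoin_open_self
  unfolding perfect_topology_def by blast

lemma Q_space_imp_perfect_topology: "Q_space X \<Longrightarrow> perfect_topology X"
  unfolding Q_space_def perfect_topology_def using openin_subset by blast

lemma qq_le_not_perfect:
  assumes "second_countable X" "separated i X" "\<not> perfect_topology X"
  shows "qq i \<le>o |topspace X|"
  using assms qq_le Q_space_imp_perfect_topology by blast

theorem proposition6:
  fixes i :: separation
  shows "smallest_cardinality
           (\<lambda>X :: real topology. second_countable X \<and> separated i X \<and> \<not> perfect_topology X) (qq i) \<and>
         (\<forall>X :: 'a topology. second_countable X \<and> separated i X \<and> \<not> perfect_topology X \<longrightarrow>
           qq i \<le>o |topspace X| )"
proof -
  obtain X :: "real topology" where X: "second_countable X" "separated i X" "\<not> Q_space X"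
      and card: "|topspace X| =o qq i" and "Card_order (qq i)"
    using smallest_cardinality_qq[of i] unfolding smallest_cardinality_def by blast
  obtain A where A: "A \<subseteq> topspace X" "\<not> fsigma_in X A"
    using X(3) unfolding Q_space_def by blast
  let ?Y = "adjoin_open X A"
  have "second_countable ?Y" "separated i ?Y" "\<not> perfect_topology ?Y"
    using second_countable_adjoin_open[OF X(1)] not_perfect_adjoin_open[OF A]
      separated_finer_topology[OF X(2) topspace_adjoin_open openin_imp_openin_adjoin_open]
    by blast+
  moreover have "|topspace ?Y| =o qq i" using card by simp
  ultimately have "smallest_cardinality
      (\<lambda>X :: real topology. second_countable X \<and> separated i X \<and> \<not> perfect_topology X) (qq i)"
    unfolding smallest_cardinality_def using \<open>Card_order (qq i)\<close> qq_le_not_perfect by blast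
  then show ?thesis using qq_le_not_perfect by blast
qed

end
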